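(* Let $q$ be a power of a prime $p>3$ with $q\equiv 1\pmod 3$ and $q>6.3\cdot 4^{13/3}$, and let $f_1,f_2,f_3\in\mathbb{F}_q[X,Y,Z]$ be of degree $3$ with $f_i(0,0,0)=0$. Let $\mathcal{S}_{f_1,f_2,f_3}\subset\mathrm{PG}(6,q)$ be the hypersurface $F(X_0,\dots,X_6)=0$, where $F$ is the homogeneous polynomial whose dehomogenization is \[ F(1,X_1,\dots,X_6)=(X_1-X_4)\big(f_3(X_4,X_5,X_6)-f_3(X_1,X_2,X_3)\big)+(X_2-X_5)\big(f_2(X_4,X_5,X_6)-f_2(X_1,X_2,X_3)\big)+(X_3-X_6)\big(f_1(X_4,X_5,X_6)-f_1(X_1,X_2,X_3)\big), \] and suppose $\mathcal{S}_{f_1,f_2,f_3}$ splits into two quadrics interchanged by the $q$-Frobenius. Then \[ \mathcal{O}_7(f_1,f_2,f_3)=\{(1,x,y,z,f_1(x,y,z),f_2(x,y,z),f_3(x,y,z),-zf_1(x,y,z)-yf_2(x,y,z)-xf_3(x,y,z)) : x,y,z\in\mathbb{F}_q\}\cup\{(0,0,0,0,0,0,0,1)\} \] is not an ovoid of the hyperbolic quadric $Q: X_0X_7+X_1X_6+X_2X_5+X_3X_4=0$ of $\mathrm{PG}(7,q)$.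
   Context: An ovoid of $Q$ is a set of points of $Q$ meeting every generator (maximal totally singular subspace) of $Q$ in exactly one point. "Splits into two quadrics interchanged by the $q$-Frobenius" means $F$ factors over $\mathbb{F}_{q^2}$ as $(R+\xi S)(R+\xi^qS)$ with $R,S$ polynomials of degree at most $2$ over $\mathbb{F}_q$ and $\xi\in\mathbb{F}_{q^2}\setminus\mathbb{F}_q$, the $q$-Frobenius acting on coefficients. *)

theory Defs
  imports
    "HOL-Analysis.Analysis"
    "HOL-Algebra.Algebraic_Closure_Type"
    "HOL-Library.Poly_Mapping"
    "HOL-Number_Theory.Cong"
begin

subsection \<open>Multivariate polynomials\<close>

text \<open>
  Polynomials are finitely supported maps from exponent vectors to coefficients, with the
  convolution product of \<^theory>\<open>HOL-Library.Poly_Mapping\<close>. The variables are the elements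
  of the index type, so a polynomial in \<open>X, Y, Z\<close> is indexed by the numeral type \<open>3\<close>
  (elements \<open>0, 1, 2\<close>) and a polynomial in \<open>X\<^sub>0, \<dots>, X\<^sub>6\<close> by \<open>7\<close> (elements \<open>0, \<dots>, 6\<close>).
\<close>

type_synonym ('v, 'a) mpoly = "('v \<Rightarrow>\<^sub>0 nat) \<Rightarrow>\<^sub>0 'a"

definition Var :: "'v \<Rightarrow> ('v, 'a::comm_ring_1) mpoly" where
  "Var v = Poly_Mapping.single (Poly_Mapping.single v 1) 1"

definition Const :: "'a \<Rightarrow> ('v, 'a::comm_ring_1) mpoly" where
  "Const c = Poly_Mapping.single 0 c"

text \<open>
  \<open>subst \<phi> \<sigma> P\<close> applies \<open>\<phi>\<close> to the coefficients of \<open>P\<close> and puts \<open>\<sigma> v\<close> for the variable \<open>v\<close>.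
\<close>

definition subst ::
  "('a \<Rightarrow> 'b) \<Rightarrow> ('v \<Rightarrow> 'b) \<Rightarrow> ('v, 'a::comm_ring_1) mpoly \<Rightarrow> 'b::comm_ring_1" where
  "subst \<phi> \<sigma> P =
     (\<Sum>m\<in>Poly_Mapping.keys P. \<phi> (Poly_Mapping.lookup P m) *
        (\<Prod>v\<in>Poly_Mapping.keys m. \<sigma> v ^ Poly_Mapping.lookup m v))"

definition triple :: "'b \<Rightarrow> 'b \<Rightarrow> 'b \<Rightarrow> 3 \<Rightarrow> 'b" where
  "triple a b c = (\<lambda>i. if i = 0 then a else if i = 1 then b else c)"

definition eval3 :: "(3, 'a::comm_ring_1) mpoly \<Rightarrow> 'a \<Rightarrow> 'a \<Rightarrow> 'a \<Rightarrow> 'a" where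
  "eval3 f x y z = subst (\<lambda>c. c) (triple x y z) f"

definition subst3 ::
  "(3, 'a) mpoly \<Rightarrow> ('v, 'a) mpoly \<Rightarrow> ('v, 'a) mpoly \<Rightarrow> ('v, 'a) mpoly \<Rightarrow> ('v, 'a::comm_ring_1) mpoly"
  where "subst3 f A B C = subst Const (triple A B C) f"

definition mon_degree :: "('v \<Rightarrow>\<^sub>0 nat) \<Rightarrow> nat" where
  "mon_degree m = (\<Sum>v\<in>Poly_Mapping.keys m. Poly_Mapping.lookup m v)"

definition total_degree :: "('v, 'a::zero) mpoly \<Rightarrow> nat" where
  "total_degree P = Max (insert 0 (mon_degree ` Poly_Mapping.keys P))"

definition homogenize :: "'v \<Rightarrow> ('v, 'a::comm_ring_1) mpoly \<Rightarrow> ('v, 'a) mpoly" where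
  "homogenize v P =
     (\<Sum>m\<in>Poly_Mapping.keys P.
        Poly_Mapping.single (m + Poly_Mapping.single v (total_degree P - mon_degree m))
          (Poly_Mapping.lookup P m))"


subsection \<open>The hypersurface\<close>

definition dehomogenized_F ::
  "(3, 'a) mpoly \<Rightarrow> (3, 'a) mpoly \<Rightarrow> (3, 'a) mpoly \<Rightarrow> (7, 'a::comm_ring_1) mpoly" where
  "dehomogenized_F f\<^sub>1 f\<^sub>2 f\<^sub>3 =
     (Var 1 - Var 4) * (subst3 f\<^sub>3 (Var 4) (Var 5) (Var 6) - subst3 f\<^sub>3 (Var 1) (Var 2) (Var 3)) +
     (Var 2 - Var 5) * (subst3 f\<^sub>2 (Var 4) (Var 5) (Var 6) - subst3 f\<^sub>2 (Var 1) (Var 2) (Var 3)) +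
     (Var 3 - Var 6) * (subst3 f\<^sub>1 (Var 4) (Var 5) (Var 6) - subst3 f\<^sub>1 (Var 1) (Var 2) (Var 3))"

definition hypersurface_F ::
  "(3, 'a) mpoly \<Rightarrow> (3, 'a) mpoly \<Rightarrow> (3, 'a) mpoly \<Rightarrow> (7, 'a::comm_ring_1) mpoly" where
  "hypersurface_F f\<^sub>1 f\<^sub>2 f\<^sub>3 = homogenize 0 (dehomogenized_F f\<^sub>1 f\<^sub>2 f\<^sub>3)"

text \<open>
  For the finite field \<open>'a\<close> of order \<open>q\<close>, the field of order \<open>q\<^sup>2\<close> is taken inside the algebraic
  closure of \<open>'a\<close>, where it consists of the roots of \<open>T\<^bsup>q\<^sup>2\<^esup> - T\<close>; the copy of \<open>'a\<close> in it is the
  range of \<^const>\<open>to_ac\<close>.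
\<close>

definition quadratic_extension :: "'a::{field,finite} alg_closure set" where
  "quadratic_extension = {x. x ^ (CARD('a)\<^sup>2) = x}"

definition splits_into_conjugate_quadrics :: "('v, 'a::{field,finite}) mpoly \<Rightarrow> bool" where
  "splits_into_conjugate_quadrics F \<longleftrightarrow>
     (\<exists>(R :: ('v, 'a) mpoly) (S :: ('v, 'a) mpoly) (\<xi> :: 'a alg_closure).
        total_degree R \<le> 2 \<and> total_degree S \<le> 2 \<and>
        \<xi> \<in> quadratic_extension - range to_ac \<and>
        Poly_Mapping.map to_ac F =
          (Poly_Mapping.map to_ac R + Const \<xi> * Poly_Mapping.map to_ac S) *
          (Poly_Mapping.map to_ac R + Const (\<xi> ^ CARD('a)) * Poly_Mapping.map to_ac S))"


subsection \<open>Quadrics and ovoids\<close>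

text \<open>
  Subspaces of the projective space over \<open>'a ^ 'n\<close> are represented by linear subspaces; a
  projective point is the span of a nonzero vector, and it lies on a subspace if it is
  contained in it.
\<close>

abbreviation proj_point :: "'a::field ^ 'n \<Rightarrow> ('a ^ 'n) set" where
  "proj_point v \<equiv> vec.span {v}"

definition quadric_points :: "('a::field ^ 'n \<Rightarrow> 'a) \<Rightarrow> ('a ^ 'n) set set" where
  "quadric_points Q = {proj_point v | v. v \<noteq> 0 \<and> Q v = 0}"

definition totally_singular :: "('a::field ^ 'n \<Rightarrow> 'a) \<Rightarrow> ('a ^ 'n) set \<Rightarrow> bool" where
  "totally_singular Q U \<longleftrightarrow> vec.subspace U \<and> (\<forall>u\<in>U. Q u = 0)"

definition generator :: "('a::field ^ 'n \<Rightarrow> 'a) \<Rightarrow> ('a ^ 'n) set \<Rightarrow> bool" where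
  "generator Q U \<longleftrightarrow>
     totally_singular Q U \<and> (\<forall>W. totally_singular Q W \<and> U \<subseteq> W \<longrightarrow> W = U)"

definition ovoid :: "('a::field ^ 'n \<Rightarrow> 'a) \<Rightarrow> ('a ^ 'n) set set \<Rightarrow> bool" where
  "ovoid Q \<O> \<longleftrightarrow>
     \<O> \<subseteq> quadric_points Q \<and> (\<forall>U. generator Q U \<longrightarrow> (\<exists>!P. P \<in> \<O> \<and> P \<subseteq> U))"

text \<open>
  The coordinate \<open>X\<^sub>i\<close> of \<open>v\<close> is \<open>v $ i\<close>, with \<open>i = 0, \<dots>, 7\<close> in the numeral type \<open>8\<close>
  (where \<open>8 = 0\<close>).
\<close>

definition hyperbolic_form :: "'a::field ^ 8 \<Rightarrow> 'a" where
  "hyperbolic_form v = v $ 0 * v $ 7 + v $ 1 * v $ 6 + v $ 2 * v $ 5 + v $ 3 * v $ 4"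

definition coords8 ::
  "'a \<Rightarrow> 'a \<Rightarrow> 'a \<Rightarrow> 'a \<Rightarrow> 'a \<Rightarrow> 'a \<Rightarrow> 'a \<Rightarrow> 'a \<Rightarrow> 'a::field ^ 8" where
  "coords8 a\<^sub>0 a\<^sub>1 a\<^sub>2 a\<^sub>3 a\<^sub>4 a\<^sub>5 a\<^sub>6 a\<^sub>7 =
     (\<chi> i. if i = 0 then a\<^sub>0 else if i = 1 then a\<^sub>1 else if i = 2 then a\<^sub>2 else if i = 3 then a\<^sub>3
           else if i = 4 then a\<^sub>4 else if i = 5 then a\<^sub>5 else if i = 6 then a\<^sub>6 else a\<^sub>7)"

definition O7 ::
  "(3, 'a) mpoly \<Rightarrow> (3, 'a) mpoly \<Rightarrow> (3, 'a) mpoly \<Rightarrow> ('a::field ^ 8) set set" where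
  "O7 f\<^sub>1 f\<^sub>2 f\<^sub>3 =
     {proj_point (coords8 1 x y z (eval3 f\<^sub>1 x y z) (eval3 f\<^sub>2 x y z) (eval3 f\<^sub>3 x y z)
        (- z * eval3 f\<^sub>1 x y z - y * eval3 f\<^sub>2 x y z - x * eval3 f\<^sub>3 x y z)) | x y z. True}
     \<union> {proj_point (coords8 0 0 0 0 0 0 0 1)}"

end

theory Submission
  imports Defs "HOL-Number_Theory.Residues"
begin

text \<open>
  The splitting is already impossible on its own. Write a pair of points as \<open>(w + u, w - u)\<close> and let
  \<open>g\<close> be the cubic part of \<open>f = (f\<^sub>3, f\<^sub>2, f\<^sub>1)\<close>. Completing the square turns the splitting into
  \<open>- 2 u \<cdot> (f(w + u) - f(w - u)) = R\<^sup>2 - d S\<^sup>2\<close> with \<open>d\<close> a nonsquare of \<open>\<F>\<^sub>q\<close>. Both quadrics contain the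
  diagonal \<open>u = 0\<close>, so \<open>R = a\<^sub>1(u) + a\<^sub>2(u) + L(u,w)\<close> and \<open>S = b\<^sub>1(u) + b\<^sub>2(u) + M(u,w)\<close> with \<open>L\<close>, \<open>M\<close>
  bilinear. The parts of bidegree \<open>(2,2)\<close>, \<open>(3,1)\<close> and \<open>(4,0)\<close> give
  \<open>L\<^sup>2 - d M\<^sup>2 = - 4 u \<cdot> Dg(w)u\<close>, \<open>a\<^sub>2 L = d b\<^sub>2 M\<close> and \<open>a\<^sub>2\<^sup>2 - d b\<^sub>2\<^sup>2 = - 4 u \<cdot> g(u)\<close>. At \<open>w = u\<close>,
  Euler's identity yields \<open>L\<^sup>2 - d M\<^sup>2 = 3 (a\<^sub>2\<^sup>2 - d b\<^sub>2\<^sup>2)\<close>; as \<open>- 3\<close> is a square for \<open>q \<equiv> 1 (mod 3)\<close>, this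
  and the second identity force \<open>L(u,u) = M(u,u) = 0\<close>. Hence \<open>L\<close> and \<open>M\<close> are alternating,
  \<open>u \<cdot> Dg(w)u\<close> is symmetric in \<open>u\<close> and \<open>w\<close>, and polarising \<open>u \<cdot> g(u) = 0\<close> gives \<open>g = 0\<close>.
\<close>

subsection \<open>Finite fields\<close>

lemma CARD_field_gt_1: "CARD('a::{field,finite}) > 1"
  using card_mono[of UNIV "{0, 1::'a}"] by simp

text \<open>Multiplication by a nonzero \<open>x\<close> permutes the nonzero elements; comparing
  the products of all of them gives \<open>x ^ (CARD('a) - 1) = 1\<close>.\<close>

lemma finite_field_power_CARD:
  fixes x :: "'a::{field,finite}"
  shows "x ^ CARD('a) = x"
proof (cases "x = 0")
  case False
  have "(\<Prod>y\<in>UNIV-{0}. x * y) = (\<Prod>y\<in>UNIV-{0}. y)"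
    by (rule prod.reindex_bij_witness[of _ "\<lambda>y. y / x" "\<lambda>y. x * y"]) (use False in auto)
  then have "x ^ (CARD('a) - 1) = 1"
    by (simp add: prod.distrib)
  then show ?thesis
    by (metis Suc_diff_1 finite_UNIV_card_ge_0 finite mult.right_neutral power_Suc)
qed (simp add: finite_UNIV_card_ge_0)

text \<open>A nonzero polynomial of degree below the field size cannot vanish everywhere. This
  converts identities between functions on the finite field into identities between
  coefficients.\<close>

lemma power_sum_eq_0_imp_coeff_eq_0:
  fixes c :: "nat \<Rightarrow> 'a::{idom,finite}"
  assumes "\<And>x. (\<Sum>i\<le>n. c i * x ^ i) = 0" and "n < CARD('a)" and "i \<le> n"
  shows "c i = 0"
proof -
  define P where "P = (\<Sum>i\<le>n. Polynomial.monom (c i) i)"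
  have "Polynomial.degree P \<le> n"
    unfolding P_def by (intro degree_sum_le) (auto intro: order.trans[OF degree_monom_le])
  moreover have "poly P x = 0" for x
    using assms(1)[of x] by (simp add: P_def poly_sum poly_monom)
  ultimately have "P = 0"
    using assms(2) by (intro poly_eqI_degree[of UNIV]) auto
  then have "poly.coeff P i = 0"
    by simp
  moreover have "poly.coeff P i = c i"
    using assms(3) by (simp add: P_def coeff_sum)
  ultimately show ?thesis by simp
qed

lemma quadratic_coeffs_eq_0:
  fixes a b c :: "'a::{idom,finite}"
  assumes "\<And>x. a + b * x + c * x ^ 2 = 0" and "2 < CARD('a)"
  shows "a = 0" "b = 0" "c = 0"
proof -
  have "(\<Sum>i\<le>2. ([a,b,c] ! i) * x ^ i) = 0" for x
    using assms(1)[of x] by (simp add: numeral_eq_Suc)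
  note * = power_sum_eq_0_imp_coeff_eq_0[OF this assms(2)]
  show "a = 0" "b = 0" "c = 0"
    using *[of 0] *[of 1] *[of 2] by simp_all
qed

lemma quartic_coeffs_eq_0:
  fixes a b c d e :: "'a::{idom,finite}"
  assumes "\<And>x. a + b * x + c * x ^ 2 + d * x ^ 3 + e * x ^ 4 = 0" and "4 < CARD('a)"
  shows "a = 0" "b = 0" "c = 0" "d = 0" "e = 0"
proof -
  have "(\<Sum>i\<le>4. ([a,b,c,d,e] ! i) * x ^ i) = 0" for x
    using assms(1)[of x] by (simp add: numeral_eq_Suc)
  note * = power_sum_eq_0_imp_coeff_eq_0[OF this assms(2)]
  show "a = 0" "b = 0" "c = 0" "d = 0" "e = 0"
    using *[of 0] *[of 1] *[of 2] *[of 3] *[of 4] by simp_all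
qed

text \<open>A primitive cube root of unity \<open>w\<close> satisfies
  \<open>(2 * w + 1) ^ 2 = - 3\<close>; for a field of order \<open>3 * k + 1\<close> a suitable
  power \<open>x ^ k\<close> is one.\<close>

lemma minus_3_square:
  assumes "[CARD('a::{field,finite}) = 1] (mod 3)"
  shows "\<exists>r::'a. r ^ 2 = - 3"
proof -
  have "CARD('a) > 1"
    by (rule CARD_field_gt_1)
  obtain k where k: "CARD('a) = 3 * k + 1"
    using assms by (metis cong_def One_nat_def mod_less one_less_numeral_iff semiring_norm(77)
        mult_div_mod_eq)
  then have "k > 0"
    using \<open>CARD('a) > 1\<close> by simp
  \<comment> \<open>Taking X^(k+1) - X instead of X^k - 1 makes every non-root nonzero, and the
    degree \<open>k + 1\<close> is still below \<open>3 * k + 1\<close>.\<close>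
  define P where "P = Polynomial.monom (1::'a) (k + 1) - Polynomial.monom 1 1"
  have "poly.coeff P (k + 1) = 1"
    using \<open>k > 0\<close> by (simp add: P_def)
  then have "P \<noteq> 0" by auto
  have "Polynomial.degree P \<le> k + 1"
    unfolding P_def by (intro degree_diff_le) (auto intro: order.trans[OF degree_monom_le])
  with card_poly_roots_bound[OF \<open>P \<noteq> 0\<close>] have "card {x. poly P x = 0} < CARD('a)"
    using k \<open>k > 0\<close> by linarith
  then obtain x where "poly P x \<noteq> 0"
    by (metis (mono_tags, lifting) UNIV_eq_I mem_Collect_eq less_irrefl)
  then have x: "x \<noteq> 0" "x ^ k \<noteq> 1"
    using \<open>k > 0\<close> by (auto simp: P_def poly_monom)
  have "x ^ (3 * k) * x = x"
    using finite_field_power_CARD[of x] k by (simp add: mult.commute)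
  then have "(x ^ k) ^ 3 = 1"
    using x by (simp add: power_mult[symmetric] mult.commute)
  moreover define w where "w = x ^ k"
  ultimately have "(w - 1) * (w ^ 2 + w + 1) = 0"
    by (simp add: algebra_simps power2_eq_square power3_eq_cube)
  then have "w ^ 2 + w + 1 = 0"
    using x by (simp add: w_def)
  then have "(2 * w + 1) ^ 2 = - 3 + 4 * 0"
    unfolding \<open>w ^ 2 + w + 1 = 0\<close>[symmetric] by (simp add: algebra_simps power2_eq_square)
  then show ?thesis by auto
qed

section \<open>Characteristic, Frobenius and the quadratic extension\<close>

lemma CHAR_eq_prime:
  assumes "CARD('a::{field,finite}) = p ^ h" and "Factorial_Ring.prime p"
  shows "CHAR('a) = p"
proof -
  have "Factorial_Ring.prime CHAR('a)"
    using prime_CHAR_semidom[where ?'a = 'a] finite_imp_CHAR_pos[where ?'a = 'a] by auto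
  moreover have "CHAR('a) dvd p ^ h"
    using CHAR_dvd_CARD[where ?'a = 'a] assms(1) by simp
  ultimately show ?thesis
    using assms(2) prime_dvd_power primes_dvd_imp_eq by blast
qed

text \<open>With q = \<open>CARD('a)\<close>, the q elements of the image are roots of X^q - X,
  which has at most q roots.\<close>

lemma range_to_ac_eq_frobenius_fixed:
  "range (to_ac :: 'a::{field,finite} \<Rightarrow> _) = {x. x ^ CARD('a) = x}"
proof -
  have "CARD('a) > 1"
    by (rule CARD_field_gt_1)
  define P where "P = Polynomial.monom (1::'a alg_closure) CARD('a) - Polynomial.monom 1 1"
  have "poly.coeff P CARD('a) = 1"
    using \<open>CARD('a) > 1\<close> by (simp add: P_def)
  then have "P \<noteq> 0" by auto
  have "Polynomial.degree P \<le> CARD('a)"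
    unfolding P_def using \<open>CARD('a) > 1\<close>
    by (intro degree_diff_le) (auto intro: order.trans[OF degree_monom_le])
  moreover have roots: "{x. poly P x = 0} = {x. x ^ CARD('a) = x}"
    by (auto simp: P_def poly_monom)
  ultimately have "finite {x::'a alg_closure. x ^ CARD('a) = x}"
    and "card {x::'a alg_closure. x ^ CARD('a) = x} \<le> CARD('a)"
    using poly_roots_finite[OF \<open>P \<noteq> 0\<close>] card_poly_roots_bound[OF \<open>P \<noteq> 0\<close>] by auto
  moreover have "range (to_ac :: 'a \<Rightarrow> _) \<subseteq> {x. x ^ CARD('a) = x}"
    by (auto simp flip: to_ac_power simp: finite_field_power_CARD)
  moreover have "card (range (to_ac :: 'a \<Rightarrow> _)) = CARD('a)"
    by (rule card_image) (rule inj_to_ac)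
  ultimately show ?thesis
    by (metis card_seteq)
qed

text \<open>Trace and norm of \<xi> are fixed by the Frobenius, hence lie in the base field. With
  \<open>t\<close> half the trace, completing the square gives the form. The square roots of
  \<open>to_ac d\<close> are \<xi> - \<open>to_ac t\<close> and its negative, so a root of
  \<open>d\<close> in the base field would put \<xi> there too.\<close>

lemma quadratic_extension_norm_form:
  fixes \<xi> :: "'a::{field,finite} alg_closure"
  assumes "Factorial_Ring.prime p" and "CARD('a) = p ^ h" and "(2::'a) \<noteq> 0"
    and "\<xi> \<in> quadratic_extension - range to_ac"
  obtains t d :: 'a where "\<nexists>e. d = e ^ 2"
    and "\<And>r s. (to_ac r + \<xi> * to_ac s) * (to_ac r + \<xi> ^ CARD('a) * to_ac s) =
           to_ac ((r + t * s) ^ 2 - d * s ^ 2)"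
proof -
  let ?q = "CARD('a)"
  have char: "CHAR('a) = p"
    by (rule CHAR_eq_prime[OF assms(2,1)])
  have frob2: "(\<xi> ^ ?q) ^ ?q = \<xi>"
    using assms(4) by (simp add: quadratic_extension_def power2_eq_square power_mult)
  have "(\<xi> + \<xi> ^ ?q) ^ ?q = \<xi> + \<xi> ^ ?q"
    using freshmans_dream'[of ?q h \<xi> "\<xi> ^ ?q"] assms(1,2) char frob2
    by (simp add: add.commute)
  then obtain tr :: 'a where tr: "to_ac tr = \<xi> + \<xi> ^ ?q"
    using range_to_ac_eq_frobenius_fixed[where 'a = 'a] by (metis (mono_tags) mem_Collect_eq rangeE)
  have "(\<xi> * \<xi> ^ ?q) ^ ?q = \<xi> * \<xi> ^ ?q"
    by (simp add: power_mult_distrib frob2 mult.commute)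
  then obtain n :: 'a where n: "to_ac n = \<xi> * \<xi> ^ ?q"
    using range_to_ac_eq_frobenius_fixed[where 'a = 'a] by (metis (mono_tags) mem_Collect_eq rangeE)
  define t where "t = tr / 2"
  define d where "d = t ^ 2 - n"
  have tr2: "tr = 2 * t"
    using assms(3) by (simp add: t_def)
  have t: "\<xi> ^ ?q = 2 * to_ac t - \<xi>"
    using tr tr2 by (simp add: algebra_simps)
  have d: "to_ac d = (\<xi> - to_ac t) ^ 2"
    by (simp add: d_def n t power2_eq_square algebra_simps)
  show ?thesis
  proof
    show "\<nexists>e. d = e ^ 2"
    proof
      assume "\<exists>e. d = e ^ 2"
      then obtain e where "d = e ^ 2" ..
      then have "(\<xi> - to_ac t) ^ 2 = to_ac e ^ 2"
        using d by simp
      then have "\<xi> - to_ac t = to_ac e \<or> \<xi> - to_ac t = - to_ac e"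
        by (simp add: power2_eq_iff)
      then have "\<xi> = to_ac (t + e) \<or> \<xi> = to_ac (t - e)"
        by (auto simp: algebra_simps)
      then show False
        using assms(4) by blast
    qed
    show "(to_ac r + \<xi> * to_ac s) * (to_ac r + \<xi> ^ CARD('a) * to_ac s) =
           to_ac ((r + t * s) ^ 2 - d * s ^ 2)" for r s
      by (simp add: d) (simp add: t power2_eq_square algebra_simps)
  qed
qed

subsection \<open>Evaluation of polynomials\<close>

text \<open>The product runs over all variables, not only over the keys: absent variables contribute
  1, and multiplicativity in \<open>m\<close> needs no comparison of supports.\<close>

definition mon_eval :: "('v::finite \<Rightarrow> 'a::comm_ring_1) \<Rightarrow> ('v \<Rightarrow>\<^sub>0 nat) \<Rightarrow> 'a" where
  "mon_eval \<sigma> m = (\<Prod>v\<in>UNIV. \<sigma> v ^ Poly_Mapping.lookup m v)"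

abbreviation eval_mpoly :: "('v::finite \<Rightarrow> 'a::comm_ring_1) \<Rightarrow> ('v, 'a) mpoly \<Rightarrow> 'a" where
  "eval_mpoly \<equiv> subst (\<lambda>c. c)"

lemma mon_eval_add: "mon_eval \<sigma> (m + n) = mon_eval \<sigma> m * mon_eval \<sigma> n"
  by (simp add: mon_eval_def lookup_add power_add prod.distrib)

lemma mon_eval_0 [simp]: "mon_eval \<sigma> 0 = 1"
  by (simp add: mon_eval_def)

lemma mon_eval_single [simp]: "mon_eval \<sigma> (Poly_Mapping.single v k) = \<sigma> v ^ k"
proof -
  have "mon_eval \<sigma> (Poly_Mapping.single v k) = (\<Prod>w\<in>{v}. \<sigma> w ^ k)"
    unfolding mon_eval_def
    by (intro prod.mono_neutral_cong_right) (auto simp: lookup_single when_def)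
  then show ?thesis by simp
qed

lemma prod_keys_eq_mon_eval:
  "(\<Prod>v\<in>Poly_Mapping.keys m. \<sigma> v ^ Poly_Mapping.lookup m v) = mon_eval \<sigma> m"
  unfolding mon_eval_def by (intro prod.mono_neutral_left) (auto simp: in_keys_iff)

lemma mon_degree_eq_sum: "mon_degree m = (\<Sum>v\<in>(UNIV::'v::finite set). Poly_Mapping.lookup m v)"
  unfolding mon_degree_def by (intro sum.mono_neutral_left) (auto simp: in_keys_iff)

lemma subst_eq_sum:
  "subst \<phi> \<sigma> P = (\<Sum>m\<in>Poly_Mapping.keys P. \<phi> (Poly_Mapping.lookup P m) * mon_eval \<sigma> m)"
  by (simp add: subst_def prod_keys_eq_mon_eval)

lemma eval_mpoly_superset:
  assumes "finite A" "Poly_Mapping.keys P \<subseteq> A"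
  shows "eval_mpoly \<sigma> P = (\<Sum>m\<in>A. Poly_Mapping.lookup P m * mon_eval \<sigma> m)"
  unfolding subst_eq_sum using assms
  by (intro sum.mono_neutral_left) (auto simp: in_keys_iff)

lemma eval_mpoly_0 [simp]: "eval_mpoly \<sigma> 0 = 0"
  by (simp add: subst_eq_sum)

lemma eval_mpoly_single [simp]:
  "eval_mpoly \<sigma> (Poly_Mapping.single m c) = c * mon_eval \<sigma> m"
  by (subst eval_mpoly_superset[of "{m}"]) (auto simp: lookup_single)

lemma eval_mpoly_Var [simp]: "eval_mpoly \<sigma> (Var v) = \<sigma> v"
  by (simp add: Var_def)

lemma eval_mpoly_Const [simp]: "eval_mpoly \<sigma> (Const c) = c"
  by (simp add: Const_def)

lemma eval_mpoly_add [simp]: "eval_mpoly \<sigma> (P + Q) = eval_mpoly \<sigma> P + eval_mpoly \<sigma> Q"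
proof -
  let ?A = "Poly_Mapping.keys P \<union> Poly_Mapping.keys Q"
  have "Poly_Mapping.keys (P + Q) \<subseteq> ?A"
    by (rule keys_add)
  then show ?thesis
    by (simp add: eval_mpoly_superset[of ?A] lookup_add distrib_right sum.distrib)
qed

lemma eval_mpoly_diff [simp]: "eval_mpoly \<sigma> (P - Q) = eval_mpoly \<sigma> P - eval_mpoly \<sigma> Q"
  using eval_mpoly_add[of \<sigma> "P - Q" Q] by (simp add: algebra_simps)

lemma eval_mpoly_sum [simp]: "eval_mpoly \<sigma> (\<Sum>i\<in>A. P i) = (\<Sum>i\<in>A. eval_mpoly \<sigma> (P i))"
  by (induction A rule: infinite_finite_induct) simp_all

lemma sum_single_lookup:
  "(\<Sum>m\<in>Poly_Mapping.keys P. Poly_Mapping.single m (Poly_Mapping.lookup P m)) = P"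
  by (rule poly_mapping_eqI)
     (auto simp: lookup_sum lookup_single when_def sum.delta in_keys_iff)

lemma eval_mpoly_mult [simp]: "eval_mpoly \<sigma> (P * Q) = eval_mpoly \<sigma> P * eval_mpoly \<sigma> Q"
proof -
  let ?c = Poly_Mapping.lookup and ?K = Poly_Mapping.keys
  have "P * Q = (\<Sum>m\<in>?K P. Poly_Mapping.single m (?c P m)) * (\<Sum>n\<in>?K Q. Poly_Mapping.single n (?c Q n))"
    by (simp add: sum_single_lookup)
  also have "\<dots> = (\<Sum>m\<in>?K P. \<Sum>n\<in>?K Q. Poly_Mapping.single (m + n) (?c P m * ?c Q n))"
    by (simp add: sum_product mult_single)
  finally have "eval_mpoly \<sigma> (P * Q) =
      (\<Sum>m\<in>?K P. \<Sum>n\<in>?K Q. (?c P m * mon_eval \<sigma> m) * (?c Q n * mon_eval \<sigma> n))"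
    by (simp add: mon_eval_add mult_ac)
  then show ?thesis
    by (simp add: subst_eq_sum sum_product)
qed

lemma eval_mpoly_1 [simp]: "eval_mpoly \<sigma> 1 = 1"
  using eval_mpoly_single[of \<sigma> 0 1] by (simp del: eval_mpoly_single)

lemma eval_mpoly_power [simp]: "eval_mpoly \<sigma> (P ^ n) = eval_mpoly \<sigma> P ^ n"
  by (induction n) simp_all

lemma eval_mpoly_prod [simp]: "eval_mpoly \<sigma> (\<Prod>i\<in>A. P i) = (\<Prod>i\<in>A. eval_mpoly \<sigma> (P i))"
  by (induction A rule: infinite_finite_induct) simp_all

lemma eval_mpoly_subst3 [simp]:
  "eval_mpoly \<sigma> (subst3 f A B C) = eval3 f (eval_mpoly \<sigma> A) (eval_mpoly \<sigma> B) (eval_mpoly \<sigma> C)"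
proof -
  have "eval_mpoly \<sigma> (triple A B C v) =
      triple (eval_mpoly \<sigma> A) (eval_mpoly \<sigma> B) (eval_mpoly \<sigma> C) v" for v
    by (simp add: triple_def)
  then show ?thesis
    unfolding subst3_def eval3_def subst_eq_sum[of Const] subst_eq_sum[where \<sigma> = "triple _ _ _"]
    by (simp add: mon_eval_def)
qed

lemma eval_mpoly_homogenize:
  assumes "\<sigma> v = 1"
  shows "eval_mpoly \<sigma> (homogenize v P) = eval_mpoly \<sigma> P"
  unfolding homogenize_def eval_mpoly_sum eval_mpoly_single
  by (simp add: mon_eval_add assms subst_eq_sum)

lemma eval_mpoly_map_to_ac:
  "eval_mpoly (\<lambda>v. to_ac (\<sigma> v)) (Poly_Mapping.map to_ac P) = to_ac (eval_mpoly \<sigma> P)"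
proof -
  have "Poly_Mapping.keys (Poly_Mapping.map to_ac P) \<subseteq> Poly_Mapping.keys P"
    by (auto simp: in_keys_iff map.rep_eq)
  then show ?thesis
    by (simp add: eval_mpoly_superset[of "Poly_Mapping.keys P"] map.rep_eq to_ac_sum mon_eval_def
        to_ac_prod when_def in_keys_iff)
qed

lemma eval_hypersurface_F:
  assumes "\<sigma> 0 = 1"
  shows "eval_mpoly \<sigma> (hypersurface_F f\<^sub>1 f\<^sub>2 f\<^sub>3) =
     (\<sigma> 1 - \<sigma> 4) * (eval3 f\<^sub>3 (\<sigma> 4) (\<sigma> 5) (\<sigma> 6) - eval3 f\<^sub>3 (\<sigma> 1) (\<sigma> 2) (\<sigma> 3)) +
     (\<sigma> 2 - \<sigma> 5) * (eval3 f\<^sub>2 (\<sigma> 4) (\<sigma> 5) (\<sigma> 6) - eval3 f\<^sub>2 (\<sigma> 1) (\<sigma> 2) (\<sigma> 3)) +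
     (\<sigma> 3 - \<sigma> 6) * (eval3 f\<^sub>1 (\<sigma> 4) (\<sigma> 5) (\<sigma> 6) - eval3 f\<^sub>1 (\<sigma> 1) (\<sigma> 2) (\<sigma> 3))"
  by (simp add: hypersurface_F_def eval_mpoly_homogenize assms dehomogenized_F_def)

text \<open>The factorisation is read only at points with coordinates in the base field, where it
  becomes an identity in \<open>'a\<close>. The later arguments stay in \<open>'a\<close>.\<close>

lemma splitting_norm_form:
  fixes F :: "('v::finite, 'a::{field,finite}) mpoly"
  assumes "splits_into_conjugate_quadrics F"
    and "Factorial_Ring.prime p" "CARD('a) = p ^ h" "(2::'a) \<noteq> 0"
  obtains R S :: "('v, 'a) mpoly" and t d :: 'a
  where "total_degree R \<le> 2" "total_degree S \<le> 2" "\<nexists>e. d = e ^ 2"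
    and "\<And>\<sigma>. eval_mpoly \<sigma> F =
           (eval_mpoly \<sigma> R + t * eval_mpoly \<sigma> S) ^ 2 - d * eval_mpoly \<sigma> S ^ 2"
proof -
  obtain R S :: "('v, 'a) mpoly" and \<xi> where RS: "total_degree R \<le> 2" "total_degree S \<le> 2"
    "\<xi> \<in> quadratic_extension - range to_ac" and
    F: "Poly_Mapping.map to_ac F =
          (Poly_Mapping.map to_ac R + Const \<xi> * Poly_Mapping.map to_ac S) *
          (Poly_Mapping.map to_ac R + Const (\<xi> ^ CARD('a)) * Poly_Mapping.map to_ac S)"
    using assms(1) unfolding splits_into_conjugate_quadrics_def by blast
  obtain t d :: 'a where d: "\<nexists>e. d = e ^ 2" and
    norm: "\<And>r s. (to_ac r + \<xi> * to_ac s) * (to_ac r + \<xi> ^ CARD('a) * to_ac s) =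
           to_ac ((r + t * s) ^ 2 - d * s ^ 2)"
    using quadratic_extension_norm_form[OF assms(2-4) RS(3)] by metis
  have "eval_mpoly \<sigma> F = (eval_mpoly \<sigma> R + t * eval_mpoly \<sigma> S) ^ 2 - d * eval_mpoly \<sigma> S ^ 2" for \<sigma>
  proof -
    have "to_ac (eval_mpoly \<sigma> F) = eval_mpoly (\<lambda>v. to_ac (\<sigma> v)) (Poly_Mapping.map to_ac F)"
      by (simp only: eval_mpoly_map_to_ac)
    also have "\<dots> = to_ac ((eval_mpoly \<sigma> R + t * eval_mpoly \<sigma> S) ^ 2 - d * eval_mpoly \<sigma> S ^ 2)"
      unfolding F eval_mpoly_mult eval_mpoly_add eval_mpoly_Const eval_mpoly_map_to_ac by (rule norm)
    finally show ?thesis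
      by (simp only: to_ac_eq_iff)
  qed
  with RS(1,2) d show ?thesis by (rule that)
qed

text \<open>Induction on the variables: with the others fixed, the sum is a polynomial in the value
  at \<open>v\<close> whose coefficients are sums of the same kind over the fibres
  \<open>B i\<close>. On a fibre the exponents agree at \<open>v\<close>, so the remaining variables
  still separate them.\<close>

lemma power_products_independent:
  fixes c :: "('v \<Rightarrow> nat) \<Rightarrow> 'a::{idom,finite}"
  assumes "finite V" and "finite A"
    and "\<And>m m'. m \<in> A \<Longrightarrow> m' \<in> A \<Longrightarrow> (\<forall>v\<in>V. m v = m' v) \<Longrightarrow> m = m'"
    and "\<And>m v. m \<in> A \<Longrightarrow> v \<in> V \<Longrightarrow> m v < CARD('a)"
    and "\<And>x. (\<Sum>m\<in>A. c m * (\<Prod>v\<in>V. x v ^ m v)) = 0"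
    and "m \<in> A"
  shows "c m = 0"
  using assms
proof (induction V arbitrary: A m rule: finite_induct)
  case empty
  then have "A = {m}" by auto
  then show ?case
    using empty.prems(4) by simp
next
  case (insert v V)
  define B where "B i = {m\<in>A. m v = i}" for i
  \<comment> \<open>The largest admissible exponent; the fibres \<open>B i\<close> with i \<le>
    \<open>N\<close> partition \<open>A\<close>.\<close>
  define N where "N = CARD('a) - 1"
  have N: "N < CARD('a)"
    by (simp add: N_def finite_UNIV_card_ge_0)
  have "(\<Sum>m\<in>B i. c m * (\<Prod>v\<in>V. x v ^ m v)) = 0" if "i \<le> N" for i x
  proof (rule power_sum_eq_0_imp_coeff_eq_0[OF _ N that])
    fix y
    have "(\<Sum>j\<le>N. (\<Sum>m\<in>B j. c m * (\<Prod>v\<in>V. x v ^ m v)) * y ^ j) =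
          (\<Sum>j\<le>N. \<Sum>m\<in>B j. c m * (\<Prod>w\<in>insert v V. (x(v := y)) w ^ m w))"
    proof -
      have "(\<Prod>w\<in>insert v V. (x(v := y)) w ^ m w) = y ^ m v * (\<Prod>v\<in>V. x v ^ m v)" for m
      proof -
        have "(\<Prod>w\<in>V. (x(v := y)) w ^ m w) = (\<Prod>v\<in>V. x v ^ m v)"
          using insert.hyps by (intro prod.cong) auto
        then show ?thesis
          using insert.hyps by simp
      qed
      then show ?thesis
        by (auto simp: sum_distrib_left B_def mult_ac intro!: sum.cong)
    qed
    also have "\<dots> = (\<Sum>m\<in>A. c m * (\<Prod>w\<in>insert v V. (x(v := y)) w ^ m w))"
    proof -
      have "(\<lambda>m. m v) ` A \<subseteq> {..N}"
        using insert.prems(3)[of _ v] by (force simp: N_def)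
      then show ?thesis
        unfolding B_def using insert.prems(1) by (intro sum.group) auto
    qed
    finally show "(\<Sum>j\<le>N. (\<Sum>m\<in>B j. c m * (\<Prod>v\<in>V. x v ^ m v)) * y ^ j) = 0"
      using insert.prems(4) by simp
  qed
  moreover have "m v \<le> N"
    using insert.prems(3)[of m v] insert.prems(5) by (simp add: N_def)
  ultimately show ?case
    using insert.prems by (intro insert.IH[of "B (m v)"]) (auto simp: B_def)
qed

subsection \<open>Homogeneous parts and multilinear forms\<close>

text \<open>Vectors are plain functions, the type of the assignments taken by \<open>subst\<close>,
  so forms apply directly to evaluation points.\<close>

definition vadd :: "('v \<Rightarrow> 'a::comm_ring_1) \<Rightarrow> ('v \<Rightarrow> 'a) \<Rightarrow> 'v \<Rightarrow> 'a" where
  "vadd x y = (\<lambda>i. x i + y i)"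

definition vscale :: "'a::comm_ring_1 \<Rightarrow> ('v \<Rightarrow> 'a) \<Rightarrow> 'v \<Rightarrow> 'a" where
  "vscale c x = (\<lambda>i. c * x i)"

lemma vadd_apply: "vadd x y i = x i + y i"
  by (simp add: vadd_def)

lemma vscale_apply: "vscale c x i = c * x i"
  by (simp add: vscale_def)

definition linear_fun :: "(('v \<Rightarrow> 'a::comm_ring_1) \<Rightarrow> 'a) \<Rightarrow> bool" where
  "linear_fun l \<longleftrightarrow> (\<forall>x y. l (vadd x y) = l x + l y) \<and> (\<forall>c x. l (vscale c x) = c * l x)"

definition bilinear_fun :: "(('v \<Rightarrow> 'a::comm_ring_1) \<Rightarrow> ('w \<Rightarrow> 'a) \<Rightarrow> 'a) \<Rightarrow> bool" where
  "bilinear_fun B \<longleftrightarrow> (\<forall>y. linear_fun (\<lambda>x. B x y)) \<and> (\<forall>x. linear_fun (B x))"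

definition trilinear_fun ::
  "(('v \<Rightarrow> 'a::comm_ring_1) \<Rightarrow> ('v \<Rightarrow> 'a) \<Rightarrow> ('v \<Rightarrow> 'a) \<Rightarrow> 'a) \<Rightarrow> bool" where
  "trilinear_fun T \<longleftrightarrow>
     (\<forall>y z. linear_fun (\<lambda>x. T x y z)) \<and> (\<forall>x z. linear_fun (\<lambda>y. T x y z)) \<and> (\<forall>x y. linear_fun (T x y))"

lemma linear_funD:
  assumes "linear_fun l"
  shows "l (vadd x y) = l x + l y" "l (vscale c x) = c * l x"
  using assms by (simp_all add: linear_fun_def)

lemma bilinear_funD:
  assumes "bilinear_fun B"
  shows "B (vadd x x') y = B x y + B x' y" "B (vscale c x) y = c * B x y"
    "B x (vadd y y') = B x y + B x y'" "B x (vscale c y) = c * B x y"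
  using assms by (simp_all add: bilinear_fun_def linear_fun_def)

lemma trilinear_funD:
  assumes "trilinear_fun T"
  shows "T (vadd x x') y z = T x y z + T x' y z" "T (vscale c x) y z = c * T x y z"
    "T x (vadd y y') z = T x y z + T x y' z" "T x (vscale c y) z = c * T x y z"
    "T x y (vadd z z') = T x y z + T x y z'" "T x y (vscale c z) = c * T x y z"
  using assms by (simp_all add: trilinear_fun_def linear_fun_def)

text \<open>Splitting off one variable per degree lets a form unroll directly into a multilinear
  one, without symmetrisation or division by factorials.\<close>

primrec homogeneous_fun :: "nat \<Rightarrow> (('v::finite \<Rightarrow> 'a::comm_ring_1) \<Rightarrow> 'a) \<Rightarrow> bool" where
  "homogeneous_fun 0 f \<longleftrightarrow> (\<exists>c. \<forall>x. f x = c)"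
| "homogeneous_fun (Suc n) f \<longleftrightarrow>
     (\<exists>g. (\<forall>v. homogeneous_fun n (g v)) \<and> (\<forall>x. f x = (\<Sum>v\<in>UNIV. x v * g v x)))"

lemma homogeneous_fun_0: "homogeneous_fun n (\<lambda>x. 0)"
  by (induction n) (auto intro!: exI[of _ "\<lambda>_ _. 0"])

lemma homogeneous_fun_add:
  "homogeneous_fun n f \<Longrightarrow> homogeneous_fun n g \<Longrightarrow> homogeneous_fun n (\<lambda>x. f x + g x)"
proof (induction n arbitrary: f g)
  case (Suc n)
  obtain f' where f': "\<forall>v. homogeneous_fun n (f' v)" "\<And>x. f x = (\<Sum>v\<in>UNIV. x v * f' v x)"
    using Suc.prems(1) by auto
  obtain g' where g': "\<forall>v. homogeneous_fun n (g' v)" "\<And>x. g x = (\<Sum>v\<in>UNIV. x v * g' v x)"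
    using Suc.prems(2) by auto
  show ?case
    using f' g' Suc.IH
    by (auto intro!: exI[of _ "\<lambda>v x. f' v x + g' v x"] simp: distrib_left sum.distrib)
qed auto

lemma homogeneous_fun_cmult:
  "homogeneous_fun n f \<Longrightarrow> homogeneous_fun n (\<lambda>x. c * f x)"
proof (induction n arbitrary: f)
  case (Suc n)
  obtain f' where f': "\<forall>v. homogeneous_fun n (f' v)" "\<And>x. f x = (\<Sum>v\<in>UNIV. x v * f' v x)"
    using Suc.prems(1) by auto
  show ?case
    using f' Suc.IH
    by (auto intro!: exI[of _ "\<lambda>v x. c * f' v x"] simp: sum_distrib_left mult_ac)
qed auto

lemma homogeneous_fun_sum:
  "(\<And>i. i \<in> A \<Longrightarrow> homogeneous_fun n (f i)) \<Longrightarrow> homogeneous_fun n (\<lambda>x. \<Sum>i\<in>A. f i x)"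
  by (induction A rule: infinite_finite_induct) (auto simp: homogeneous_fun_0 homogeneous_fun_add)

lemma homogeneous_fun_var_mult:
  assumes "homogeneous_fun n f"
  shows "homogeneous_fun (Suc n) (\<lambda>x. x v * f x)"
proof -
  have "x v * f x = (\<Sum>w\<in>UNIV. x w * (if w = v then f x else 0))" for x
    by (simp add: if_distrib cong: if_cong)
  moreover have "homogeneous_fun n (\<lambda>x. if w = v then f x else 0)" for w
    using assms by (cases "w = v") (simp_all add: homogeneous_fun_0)
  ultimately show ?thesis
    unfolding homogeneous_fun.simps by (intro exI[of _ "\<lambda>w x. if w = v then f x else 0"]) blast
qed

lemma homogeneous_fun_mon_eval:
  "mon_degree m = n \<Longrightarrow> homogeneous_fun n (\<lambda>x::'v::finite \<Rightarrow> 'a::comm_ring_1. mon_eval x m)"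
proof (induction n arbitrary: m)
  case 0
  then show ?case
    by (auto simp: mon_degree_eq_sum mon_eval_def)
next
  case (Suc n)
  then obtain v where v: "Poly_Mapping.lookup m v > 0"
    by (metis mon_degree_eq_sum gr0I nat.distinct(1) sum.neutral)
  define m' where "m' = m - Poly_Mapping.single v 1"
  have m: "m = Poly_Mapping.single v 1 + m'"
    using v by (intro poly_mapping_eqI)
      (auto simp: m'_def lookup_add lookup_minus lookup_single when_def)
  then have "mon_degree m = Suc (mon_degree m')"
    by (simp add: mon_degree_eq_sum lookup_add lookup_single sum.distrib when_def)
  then have "homogeneous_fun n (\<lambda>x::'v \<Rightarrow> 'a. mon_eval x m')"
    using Suc by simp
  then show ?case
    unfolding m mon_eval_add mon_eval_single power_one_right by (rule homogeneous_fun_var_mult)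
qed

definition homogeneous_part ::
  "nat \<Rightarrow> ('v::finite, 'a::comm_ring_1) mpoly \<Rightarrow> ('v \<Rightarrow> 'a) \<Rightarrow> 'a" where
  "homogeneous_part n P x =
     (\<Sum>m | m \<in> Poly_Mapping.keys P \<and> mon_degree m = n. Poly_Mapping.lookup P m * mon_eval x m)"

lemma homogeneous_fun_homogeneous_part: "homogeneous_fun n (homogeneous_part n P)"
  unfolding homogeneous_part_def[abs_def]
  by (intro homogeneous_fun_sum homogeneous_fun_cmult homogeneous_fun_mon_eval) simp

lemma eval_mpoly_eq_sum_homogeneous_parts:
  assumes "total_degree P \<le> N"
  shows "eval_mpoly x P = (\<Sum>n\<le>N. homogeneous_part n P x)"
proof -
  have "mon_degree m \<le> N" if "m \<in> Poly_Mapping.keys P" for m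
  proof -
    have "mon_degree m \<le> total_degree P"
      unfolding total_degree_def using that by (intro Max_ge) auto
    with assms show ?thesis by simp
  qed
  then have "(\<Sum>n\<le>N. \<Sum>m\<in>{m \<in> Poly_Mapping.keys P. mon_degree m = n}.
        Poly_Mapping.lookup P m * mon_eval x m)
      = (\<Sum>m\<in>Poly_Mapping.keys P. Poly_Mapping.lookup P m * mon_eval x m)"
    by (intro sum.group) auto
  then show ?thesis
    by (simp add: homogeneous_part_def subst_eq_sum)
qed

text \<open>Some monomial of degree \<open>n\<close> has a nonzero coefficient, and all exponents in
  that degree are at most \<open>n\<close>, so independence of power products applies. Positivity of
  \<open>n\<close> excludes the default value 0 inserted in \<open>total_degree\<close>.\<close>

lemma homogeneous_part_nonzero:
  fixes P :: "('v::finite, 'a::{field,finite}) mpoly"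
  assumes "total_degree P = n" "n > 0" "n < CARD('a)"
  shows "\<exists>x. homogeneous_part n P x \<noteq> 0"
proof (rule ccontr)
  assume zero: "\<nexists>x. homogeneous_part n P x \<noteq> 0"
  have "n \<in> insert 0 (mon_degree ` Poly_Mapping.keys P)"
    unfolding assms(1)[symmetric] total_degree_def by (intro Max_in) auto
  then obtain m where m: "m \<in> Poly_Mapping.keys P" "mon_degree m = n"
    using assms(2) by auto
  define A where "A = {m \<in> Poly_Mapping.keys P. mon_degree m = n}"
  \<comment> \<open>Independence is stated for exponent functions, so coefficients are transported
    along the inverse of \<open>Poly_Mapping.lookup\<close>.\<close>
  define c where "c e = Poly_Mapping.lookup P (Abs_poly_mapping e)" for e
  have abs: "Abs_poly_mapping (Poly_Mapping.lookup e) = e" for e :: "'v \<Rightarrow>\<^sub>0 nat"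
    by (rule Poly_Mapping.lookup_inverse)
  have "c (Poly_Mapping.lookup m) = 0"
  proof (rule power_products_independent[of UNIV "Poly_Mapping.lookup ` A"])
    show "(\<Sum>e\<in>Poly_Mapping.lookup ` A. c e * (\<Prod>v\<in>UNIV. x v ^ e v)) = 0" for x
      using zero
      by (subst sum.reindex)
        (auto simp: inj_on_def poly_mapping_eqI c_def abs A_def homogeneous_part_def mon_eval_def)
    show "e v < CARD('a)" if "e \<in> Poly_Mapping.lookup ` A" for e v
    proof -
      obtain m' where m': "e = Poly_Mapping.lookup m'" "mon_degree m' = n"
        using \<open>e \<in> Poly_Mapping.lookup ` A\<close> by (auto simp: A_def)
      have "e v \<le> mon_degree m'"
        unfolding m' mon_degree_eq_sum by (intro member_le_sum) auto
      with m' assms(3) show ?thesis by simp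
    qed
  qed (use m in \<open>auto simp: A_def\<close>)
  then show False
    using m by (simp add: c_def abs in_keys_iff)
qed

section \<open>Multilinear forms behind the homogeneous parts\<close>

lemma linear_fun_sum_mult:
  "linear_fun (\<lambda>x. \<Sum>v\<in>(UNIV::'v::finite set). x v * c v)"
  by (simp add: linear_fun_def vadd_def vscale_def distrib_right sum.distrib sum_distrib_left mult.assoc)

lemma homogeneous_fun_1_linear:
  assumes "homogeneous_fun (Suc 0) f"
  shows "linear_fun f"
proof -
  obtain c where "\<And>x. f x = (\<Sum>v\<in>UNIV. x v * c v)"
    using assms by (auto simp: choice_iff)
  then have "f = (\<lambda>x. \<Sum>v\<in>UNIV. x v * c v)"
    by (rule ext)
  then show ?thesis
    by (simp add: linear_fun_sum_mult)
qed

lemma linear_fun_sum_cmult: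
  "(\<And>v. linear_fun (g v)) \<Longrightarrow> linear_fun (\<lambda>x. \<Sum>v\<in>(UNIV::'v::finite set). c v * g v x)"
  by (simp add: linear_fun_def distrib_left sum.distrib sum_distrib_left mult_ac)

text \<open>In \<open>x v * g v x\<close> the factor \<open>g v\<close> is linear; letting the two
  occurrences of \<open>x\<close> vary independently gives \<open>B\<close>, which need not be
  symmetric.\<close>

lemma homogeneous_fun_2_bilinear:
  assumes "homogeneous_fun (Suc (Suc 0)) f"
  shows "\<exists>B. bilinear_fun B \<and> (\<forall>x. f x = B x x)"
proof -
  obtain g where g: "\<And>v. homogeneous_fun (Suc 0) (g v)" "\<And>x. f x = (\<Sum>v\<in>UNIV. x v * g v x)"
    using assms unfolding homogeneous_fun.simps(2)[of "Suc 0"] by blast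
  have "bilinear_fun (\<lambda>x y. \<Sum>v\<in>UNIV. x v * g v y)"
    unfolding bilinear_fun_def using homogeneous_fun_1_linear[OF g(1)]
    by (auto intro: linear_fun_sum_mult linear_fun_sum_cmult)
  with g(2) show ?thesis by blast
qed

lemma homogeneous_fun_3_trilinear:
  assumes "homogeneous_fun (Suc (Suc (Suc 0))) f"
  shows "\<exists>T. trilinear_fun T \<and> (\<forall>x. f x = T x x x)"
proof -
  obtain g where g: "\<And>v. homogeneous_fun (Suc (Suc 0)) (g v)" "\<And>x. f x = (\<Sum>v\<in>UNIV. x v * g v x)"
    using assms unfolding homogeneous_fun.simps(2)[of "Suc (Suc 0)"] by blast
  obtain B where B: "\<And>v. bilinear_fun (B v)" "\<And>v x. g v x = B v x x"
    using homogeneous_fun_2_bilinear[OF g(1)] by metis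
  have "trilinear_fun (\<lambda>x y z. \<Sum>v\<in>UNIV. x v * B v y z)"
    unfolding trilinear_fun_def using B(1)
    by (auto intro: linear_fun_sum_mult linear_fun_sum_cmult simp: bilinear_fun_def)
  with g(2) B(2) show ?thesis by auto
qed

lemma quadratic_mpoly_expansion:
  fixes P :: "('v::finite, 'a::comm_ring_1) mpoly"
  assumes "total_degree P \<le> 2"
  obtains c l B where "linear_fun l" "bilinear_fun B" "\<And>x. eval_mpoly x P = c + l x + B x x"
proof -
  obtain c where c: "\<And>x. homogeneous_part 0 P x = c"
    using homogeneous_fun_homogeneous_part[of 0 P] by auto
  obtain B where B: "bilinear_fun B" "\<And>x. homogeneous_part 2 P x = B x x"
    using homogeneous_fun_2_bilinear[OF homogeneous_fun_homogeneous_part[of "Suc (Suc 0)" P]]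
    by (auto simp: numeral_2_eq_2)
  show ?thesis
    using that[OF homogeneous_fun_1_linear[OF homogeneous_fun_homogeneous_part] B(1), of c P]
      eval_mpoly_eq_sum_homogeneous_parts[OF assms] c B(2)
    by (simp add: numeral_2_eq_2)
qed

text \<open>Tying the cubic term to \<open>homogeneous_part 3\<close> lets its vanishing contradict
  degree 3 later.\<close>

lemma cubic_mpoly_expansion:
  fixes P :: "('v::finite, 'a::comm_ring_1) mpoly"
  assumes "total_degree P \<le> 3"
  obtains c l B T where "linear_fun l" "bilinear_fun B" "trilinear_fun T"
    and "\<And>x. eval_mpoly x P = c + l x + B x x + T x x x"
    and "\<And>x. homogeneous_part 3 P x = T x x x"
proof -
  obtain c where c: "\<And>x. homogeneous_part 0 P x = c"
    using homogeneous_fun_homogeneous_part[of 0 P] by auto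
  obtain B where B: "bilinear_fun B" "\<And>x. homogeneous_part (Suc (Suc 0)) P x = B x x"
    using homogeneous_fun_2_bilinear[OF homogeneous_fun_homogeneous_part[of "Suc (Suc 0)" P]] by auto
  obtain T where T: "trilinear_fun T" "\<And>x. homogeneous_part (Suc (Suc (Suc 0))) P x = T x x x"
    using homogeneous_fun_3_trilinear[OF homogeneous_fun_homogeneous_part[of "Suc (Suc (Suc 0))" P]]
    by auto
  show ?thesis
    using that[OF homogeneous_fun_1_linear[OF homogeneous_fun_homogeneous_part] B(1) T(1), of c P]
      eval_mpoly_eq_sum_homogeneous_parts[OF assms] c B(2) T(2)
    by (simp add: numeral_3_eq_3)
qed

section \<open>Vanishing of the cubic part\<close>

text \<open>If x is nonzero, orthogonality gives (a, b) = k (d y, x), so the norm of (a, b) is - d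
  k^2 times that of (x, y). As - 3 = r^2, the norm equation becomes (x^2 - d y^2) (1 - d (r k)^2) =
  0, and either factor vanishing makes d a square. If x = 0 and y is nonzero, then b = 0 and d = (r
  a / y)^2.\<close>

lemma norm_3_multiple_eq_0:
  fixes a b d r x y :: "'a::field"
  assumes d: "\<nexists>e. d = e ^ 2" and r: "r ^ 2 = - 3"
    and orth: "a * x = d * b * y" and norm: "x ^ 2 - d * y ^ 2 = 3 * (a ^ 2 - d * b ^ 2)"
  shows "x = 0 \<and> y = 0"
proof (rule ccontr)
  assume "\<not> (x = 0 \<and> y = 0)"
  have "d \<noteq> 0"
    using d by (metis zero_power2)
  show False
  proof (cases "x = 0")
    case True
    with \<open>\<not> (x = 0 \<and> y = 0)\<close> have "y \<noteq> 0" by simp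
    with orth True \<open>d \<noteq> 0\<close> have "b = 0" by simp
    with norm True have "- (d * y ^ 2) = 3 * a ^ 2" by simp
    then have "d * y ^ 2 = r ^ 2 * a ^ 2"
      unfolding r by (metis minus_minus mult_minus_left)
    then have "d = (r * a / y) ^ 2"
      using \<open>y \<noteq> 0\<close> by (simp add: field_simps)
    with d show False by blast
  next
    case False
    define k where "k = b / x"
    have b: "b = k * x"
      using False by (simp add: k_def)
    with orth False have a: "a = k * d * y"
      by (simp add: mult_ac)
    have "(x ^ 2 - d * y ^ 2) * (1 - d * (r * k) ^ 2) = 0"
      using norm unfolding a b power_mult_distrib r by (simp add: algebra_simps power2_eq_square)
    then consider "x ^ 2 = d * y ^ 2" | "1 = d * (r * k) ^ 2"
      by auto
    then show False
    proof cases
      case 1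
      then have "y \<noteq> 0" using False by auto
      with 1 have "d = (x / y) ^ 2" by (simp add: field_simps)
      with d show False by blast
    next
      case 2
      then have "r * k \<noteq> 0" by auto
      with 2 have "d = (1 / (r * k)) ^ 2" by (simp add: field_simps)
      with d show False by blast
    qed
  qed
qed

text \<open>Scaling \<open>u\<close> and \<open>w\<close> independently isolates the bidegrees of
  the splitting identity. Those of total degree 4 involve only the cubic part of \<open>f\<close>,
  the bilinear forms and the quadratic terms \<open>a\<^sub>2\<close>,
  \<open>b\<^sub>2\<close>.\<close>

lemma cubic_part_eq_0:
  fixes f :: "'v::finite \<Rightarrow> ('v \<Rightarrow> 'a::{field,finite}) \<Rightarrow> 'a"
  assumes card: "CARD('a) > 4" and two: "(2::'a) \<noteq> 0" and three: "(3::'a) \<noteq> 0"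
    and d: "\<nexists>e. d = e ^ 2" and r: "r ^ 2 = - (3::'a)"
    and l: "\<And>i. linear_fun (l i)" and B: "\<And>i. bilinear_fun (B i)" and T: "\<And>i. trilinear_fun (T i)"
    and f: "\<And>i x. f i x = c i + l i x + B i x x + T i x x x"
    and L: "bilinear_fun L" and M: "bilinear_fun M"
    and a\<^sub>1: "\<And>t u. a\<^sub>1 (vscale t u) = t * a\<^sub>1 u" and a\<^sub>2: "\<And>t u. a\<^sub>2 (vscale t u) = t ^ 2 * a\<^sub>2 u"
    and b\<^sub>1: "\<And>t u. b\<^sub>1 (vscale t u) = t * b\<^sub>1 u" and b\<^sub>2: "\<And>t u. b\<^sub>2 (vscale t u) = t ^ 2 * b\<^sub>2 u"
    and split: "\<And>u w. - 2 * (\<Sum>i\<in>UNIV. u i * (f i (vadd w u) - f i (vadd w (vscale (- 1) u)))) =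
        (a\<^sub>1 u + a\<^sub>2 u + L u w) ^ 2 - d * (b\<^sub>1 u + b\<^sub>2 u + M u w) ^ 2"
  shows "T i x x x = 0"
proof -
  note lin = linear_funD[OF l] bilinear_funD[OF B] trilinear_funD[OF T]
    bilinear_funD[OF L] bilinear_funD[OF M]
  \<comment> \<open>With g the cubic part, \<open>H w u\<close> is w . g(u), \<open>E u w\<close> is
    u . Dg(w)u and \<open>Y u w\<close> is u . Dg(u)w. \<open>A\<close> and \<open>K\<close> collect
    the linear and quadratic parts of \<open>f\<close>.\<close>
  define E where "E u w = (\<Sum>i\<in>UNIV. u i * (T i w w u + T i w u w + T i u w w))" for u w
  define Y where "Y u w = (\<Sum>i\<in>UNIV. u i * (T i w u u + T i u w u + T i u u w))" for u w
  define H where "H w u = (\<Sum>i\<in>UNIV. w i * T i u u u)" for u w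
  define A where "A u = (\<Sum>i\<in>UNIV. u i * l i u)" for u
  define K where "K u w = (\<Sum>i\<in>UNIV. u i * (B i w u + B i u w))" for u w
  have expand: "- 4 * (t ^ 2 * A u + s * t ^ 2 * K u w + s ^ 2 * t ^ 2 * E u w + t ^ 4 * H u u) =
        (t * a\<^sub>1 u + t ^ 2 * a\<^sub>2 u + s * t * L u w) ^ 2 -
        d * (t * b\<^sub>1 u + t ^ 2 * b\<^sub>2 u + s * t * M u w) ^ 2" for u w s t
  proof -
    have "vscale t u i * (f i (vadd (vscale s w) (vscale t u)) -
            f i (vadd (vscale s w) (vscale (- 1) (vscale t u)))) =
        2 * (t ^ 2 * (u i * l i u) + s * t ^ 2 * (u i * (B i w u + B i u w)) +
          s ^ 2 * t ^ 2 * (u i * (T i w w u + T i w u w + T i u w w)) + t ^ 4 * (u i * T i u u u))" for i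
      \<comment> \<open>The difference keeps only the terms odd in \<open>u\<close>, each
        doubled.\<close>
      by (simp add: f lin vscale_apply algebra_simps power2_eq_square power4_eq_xxxx)
    then have "- 2 * (\<Sum>i\<in>UNIV. vscale t u i * (f i (vadd (vscale s w) (vscale t u)) -
            f i (vadd (vscale s w) (vscale (- 1) (vscale t u))))) =
        - 4 * (t ^ 2 * A u + s * t ^ 2 * K u w + s ^ 2 * t ^ 2 * E u w + t ^ 4 * H u u)"
      by (simp add: A_def K_def E_def H_def sum.distrib flip: sum_distrib_left)
    then show ?thesis
      unfolding split by (simp add: a\<^sub>1 a\<^sub>2 b\<^sub>1 b\<^sub>2 lin mult_ac)
  qed
  have coeffs: "L u w ^ 2 - d * M u w ^ 2 = - 4 * E u w"
      "a\<^sub>2 u * L u w = d * b\<^sub>2 u * M u w"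
      "a\<^sub>2 u ^ 2 - d * b\<^sub>2 u ^ 2 = - 4 * H u u" for u w
  proof -
    \<comment> \<open>For fixed \<open>t\<close> this is a quadratic polynomial in \<open>s\<close>.
      Its coefficients are then compared in \<open>t\<close>: \<open>t ^ 4\<close> gives bidegree
      (4,0) and \<open>t ^ 3\<close> gives (3,1); for (2,2) the value at \<open>t = 1\<close>
      suffices.\<close>
    have "(- 4 * (t ^ 2 * A u + t ^ 4 * H u u) - (t * a\<^sub>1 u + t ^ 2 * a\<^sub>2 u) ^ 2
        + d * (t * b\<^sub>1 u + t ^ 2 * b\<^sub>2 u) ^ 2)
      + (- 4 * t ^ 2 * K u w - 2 * t * L u w * (t * a\<^sub>1 u + t ^ 2 * a\<^sub>2 u)
        + 2 * d * t * M u w * (t * b\<^sub>1 u + t ^ 2 * b\<^sub>2 u)) * s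
      + (t ^ 2 * (- 4 * E u w - L u w ^ 2 + d * M u w ^ 2)) * s ^ 2 = 0" for s t
      using expand[of t u s w] by (simp add: algebra_simps power2_eq_square)
    note s = quadratic_coeffs_eq_0[OF this]
    have "0 + 0 * t + (- 4 * A u - a\<^sub>1 u ^ 2 + d * b\<^sub>1 u ^ 2) * t ^ 2
       + (2 * (d * b\<^sub>1 u * b\<^sub>2 u - a\<^sub>1 u * a\<^sub>2 u)) * t ^ 3
       + (- 4 * H u u - a\<^sub>2 u ^ 2 + d * b\<^sub>2 u ^ 2) * t ^ 4 = 0" for t
      using s(1)[of t] card by (simp add: algebra_simps power2_eq_square power3_eq_cube power4_eq_xxxx)
    from quartic_coeffs_eq_0(5)[OF this card] show "a\<^sub>2 u ^ 2 - d * b\<^sub>2 u ^ 2 = - 4 * H u u"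
      by (simp add: algebra_simps)
    have "0 + 0 * t + (- 4 * K u w - 2 * L u w * a\<^sub>1 u + 2 * d * M u w * b\<^sub>1 u) * t ^ 2
       + (2 * (d * b\<^sub>2 u * M u w - a\<^sub>2 u * L u w)) * t ^ 3 + 0 * t ^ 4 = 0" for t
      using s(2)[of t] card by (simp add: algebra_simps power2_eq_square power3_eq_cube power4_eq_xxxx)
    from quartic_coeffs_eq_0(4)[OF this card] show "a\<^sub>2 u * L u w = d * b\<^sub>2 u * M u w"
      using two by simp
    show "L u w ^ 2 - d * M u w ^ 2 = - 4 * E u w"
      using s(3)[of 1] card by (simp add: algebra_simps)
  qed
  \<comment> \<open>Euler's identity Dg(u)u = 3 g(u), paired with u.\<close>
  have "E u u = 3 * H u u" for u
    by (simp add: E_def H_def sum_distrib_left algebra_simps)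
  then have "L u u ^ 2 - d * M u u ^ 2 = 3 * (a\<^sub>2 u ^ 2 - d * b\<^sub>2 u ^ 2)" for u
    by (simp add: coeffs)
  then have alt: "L u u = 0" "M u u = 0" for u
    using norm_3_multiple_eq_0[OF d r coeffs(2)] by blast+
  have four: "(4::'a) \<noteq> 0"
    using two by (metis mult_2 numeral_Bit0 mult_eq_0_iff)
  have "E u u = 0" for u
    using coeffs(1)[of u u] alt four by simp
  then have HE: "H u u = 0" for u
    using \<open>E u u = 3 * H u u\<close> three by simp
  have antisym: "L w u = - L u w" "M w u = - M u w" for u w
  proof -
    have "L u u + L w u + (L u w + L w w) = 0" "M u u + M w u + (M u w + M w w) = 0"
      using alt[of "vadd u w"] by (simp_all only: lin)
    then show "L w u = - L u w" "M w u = - M u w"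
      by (simp_all add: alt eq_neg_iff_add_eq_0)
  qed
  \<comment> \<open>Swapping the arguments only changes the signs of \<open>L\<close> and
    \<open>M\<close>, which the squares ignore.\<close>
  have Esym: "E u w = E w u" for u w
    using coeffs(1)[of u w] coeffs(1)[of w u] antisym[of w u] four by simp
  have polar: "E u w + E w u = 0" "H w u + Y u w = 0" for u w
  proof -
    \<comment> \<open>Polarisation of u . g(u) = 0: expand along the line w + s u and compare the
      coefficients of \<open>s ^ 2\<close> and \<open>s ^ 3\<close>.\<close>
    have "H w w + (H u w + Y w u) * s + (E u w + E w u) * s ^ 2 + (H w u + Y u w) * s ^ 3
        + H u u * s ^ 4
      = H (vadd w (vscale s u)) (vadd w (vscale s u))" for s
      unfolding H_def E_def Y_def sum.distrib[symmetric] sum_distrib_right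
      by (intro sum.cong)
        (simp_all add: lin vadd_apply vscale_apply algebra_simps power2_eq_square power3_eq_cube
          power4_eq_xxxx)
    then have "H w w + (H u w + Y w u) * s + (E u w + E w u) * s ^ 2 + (H w u + Y u w) * s ^ 3
        + H u u * s ^ 4 = 0" for s
      using HE by simp
    from quartic_coeffs_eq_0[OF this card] show "E u w + E w u = 0" "H w u + Y u w = 0" by auto
  qed
  have E0: "E u w = 0" for u w
    using polar(1)[of u w] Esym[of u w] two by (simp flip: mult_2)
  have "Y u w = 0" for u w
  proof -
    \<comment> \<open>\<open>E u\<close> is quadratic in its second argument, and its polar form at
      w and u is \<open>2 * Y u w\<close>; so \<open>Y\<close> vanishes with
      \<open>E\<close>.\<close>
    have "E u (vadd w u) = E u w + 2 * Y u w + E u u"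
      unfolding E_def Y_def sum.distrib[symmetric] sum_distrib_left
      by (intro sum.cong) (simp_all add: lin algebra_simps)
    then show ?thesis
      using E0 two by simp
  qed
  \<comment> \<open>\<open>H\<close> now vanishes for independent arguments, so a unit vector
    extracts the coordinate \<open>i\<close> of g.\<close>
  then have "H (\<lambda>j. if j = i then 1 else 0) x = 0"
    using polar(2) by (metis add.right_neutral)
  then show ?thesis
    by (simp add: H_def if_distrib[of "\<lambda>z. z * _"] cong: if_cong)
qed

subsection \<open>The splitting hypersurface\<close>

text \<open>The argument \<open>c\<close> is the coordinate X_0: 1 for affine points, 0 for
  directions, so that a point is an origin plus directions.\<close>

definition pair_point :: "'a \<Rightarrow> (3 \<Rightarrow> 'a) \<Rightarrow> (3 \<Rightarrow> 'a) \<Rightarrow> 7 \<Rightarrow> 'a::comm_ring_1" where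
  "pair_point c x y = (\<lambda>i. if i = 0 then c else if i = 1 then x 0 else if i = 2 then x 1
     else if i = 3 then x 2 else if i = 4 then y 0 else if i = 5 then y 1 else y 2)"

text \<open>In the coordinates (w + u, w - u), vanishing at u = 0 removes every term in w alone.
  What remains is linear in u, quadratic in u, or bilinear in u and w.\<close>

lemma quadric_through_diagonal:
  fixes R :: "(7, 'a::{field,finite}) mpoly"
  assumes deg: "total_degree R \<le> 2" and card: "2 < CARD('a)"
    and diag: "\<And>w. eval_mpoly (pair_point 1 w w) R = 0"
  obtains a\<^sub>1 a\<^sub>2 :: "(3 \<Rightarrow> 'a) \<Rightarrow> 'a" and L where "bilinear_fun L"
    and "\<And>t u. a\<^sub>1 (vscale t u) = t * a\<^sub>1 u" and "\<And>t u. a\<^sub>2 (vscale t u) = t ^ 2 * a\<^sub>2 u"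
    and "\<And>u w. eval_mpoly (pair_point 1 (vadd w u) (vadd w (vscale (- 1) u))) R
           = a\<^sub>1 u + a\<^sub>2 u + L u w"
proof -
  obtain c l B where l: "linear_fun l" and B: "bilinear_fun B"
    and R: "\<And>x. eval_mpoly x R = c + l x + B x x"
    using quadratic_mpoly_expansion[OF deg] by metis
  note lin = linear_funD[OF l] bilinear_funD[OF B]
  \<comment> \<open>The affine origin, followed by the embeddings of the antidiagonal and diagonal
    directions.\<close>
  define e :: "7 \<Rightarrow> 'a" where "e = pair_point 1 (\<lambda>_. 0) (\<lambda>_. 0)"
  define \<iota> where "\<iota> u = pair_point 0 u (vscale (- 1) u)" for u :: "3 \<Rightarrow> 'a"
  define \<kappa> where "\<kappa> w = pair_point 0 w w" for w :: "3 \<Rightarrow> 'a"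
  have \<iota>: "\<iota> (vadd u u') = vadd (\<iota> u) (\<iota> u')" "\<iota> (vscale k u) = vscale k (\<iota> u)" for u u' k
    by (auto simp: \<iota>_def pair_point_def vadd_def vscale_def)
  have \<kappa>: "\<kappa> (vadd u u') = vadd (\<kappa> u) (\<kappa> u')" "\<kappa> (vscale k u) = vscale k (\<kappa> u)" for u u' k
    by (auto simp: \<kappa>_def pair_point_def vadd_def vscale_def)
  have point: "pair_point 1 (vadd w u) (vadd w (vscale (- 1) u)) = vadd e (vadd (\<iota> u) (\<kappa> w))" for u w
    by (auto simp: e_def \<iota>_def \<kappa>_def pair_point_def vadd_def vscale_def)
  have "(c + l e + B e e) + (l (\<kappa> w) + B e (\<kappa> w) + B (\<kappa> w) e) * s + B (\<kappa> w) (\<kappa> w) * s ^ 2 = 0" for s w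
  proof -
    have "pair_point 1 (vscale s w) (vscale s w) = vadd e (vscale s (\<kappa> w))"
      by (auto simp: e_def \<kappa>_def pair_point_def vadd_def vscale_def)
    with diag[of "vscale s w"] show ?thesis
      by (simp add: R lin algebra_simps power2_eq_square)
  qed
  note zero = quadratic_coeffs_eq_0[OF this card]
  show ?thesis
  proof
    show "bilinear_fun (\<lambda>u w. B (\<iota> u) (\<kappa> w) + B (\<kappa> w) (\<iota> u))"
      by (simp add: bilinear_fun_def linear_fun_def \<iota> \<kappa> lin algebra_simps)
    show "l (\<iota> (vscale t u)) + B e (\<iota> (vscale t u)) + B (\<iota> (vscale t u)) e
        = t * (l (\<iota> u) + B e (\<iota> u) + B (\<iota> u) e)" for t u
      by (simp add: \<iota> lin algebra_simps)
    show "B (\<iota> (vscale t u)) (\<iota> (vscale t u)) = t ^ 2 * B (\<iota> u) (\<iota> u)" for t u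
      by (simp add: \<iota> lin power2_eq_square)
    show "eval_mpoly (pair_point 1 (vadd w u) (vadd w (vscale (- 1) u))) R =
      (l (\<iota> u) + B e (\<iota> u) + B (\<iota> u) e) + B (\<iota> u) (\<iota> u) + (B (\<iota> u) (\<kappa> w) + B (\<kappa> w) (\<iota> u))" for u w
    proof -
      have "eval_mpoly (pair_point 1 (vadd w u) (vadd w (vscale (- 1) u))) R =
        (l (\<iota> u) + B e (\<iota> u) + B (\<iota> u) e) + B (\<iota> u) (\<iota> u) + (B (\<iota> u) (\<kappa> w) + B (\<kappa> w) (\<iota> u)) +
        ((c + l e + B e e) + (l (\<kappa> w) + B e (\<kappa> w) + B (\<kappa> w) e) + B (\<kappa> w) (\<kappa> w))"
        by (simp add: point R lin algebra_simps)
      then show ?thesis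
        by (simp only: zero add_0_right)
    qed
  qed
qed

lemma eval3_eq_eval_mpoly: "eval3 f (x 0) (x 1) (x 2) = eval_mpoly x f"
proof -
  have "triple (x 0) (x 1) (x 2) i = x i" for i
    using exhaust_3[of i] by (auto simp: triple_def)
  then have "triple (x 0) (x 1) (x 2) = x" ..
  then show ?thesis
    by (simp add: eval3_def)
qed

text \<open>The vanishing of the cubic part of \<open>f\<^sub>3\<close> contradicts its having
  degree exactly 3.\<close>

lemma not_splits_into_conjugate_quadrics:
  fixes f\<^sub>1 f\<^sub>2 f\<^sub>3 :: "(3, 'a::{field,finite}) mpoly"
  assumes p: "Factorial_Ring.prime p" "CARD('a) = p ^ h" and "p > 3"
    and cong: "[CARD('a) = 1] (mod 3)"
    and deg: "total_degree f\<^sub>1 \<le> 3" "total_degree f\<^sub>2 \<le> 3" "total_degree f\<^sub>3 = 3"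
  shows "\<not> splits_into_conjugate_quadrics (hypersurface_F f\<^sub>1 f\<^sub>2 f\<^sub>3)"
proof
  assume splits: "splits_into_conjugate_quadrics (hypersurface_F f\<^sub>1 f\<^sub>2 f\<^sub>3)"
  have char: "CHAR('a) = p"
    by (rule CHAR_eq_prime[OF p(2,1)])
  have "of_nat 2 \<noteq> (0::'a)" "of_nat 3 \<noteq> (0::'a)"
    unfolding of_nat_eq_0_iff_char_dvd char using \<open>p > 3\<close> by (auto dest: dvd_imp_le)
  then have two: "(2::'a) \<noteq> 0" and three: "(3::'a) \<noteq> 0"
    by simp_all
  have "p \<le> CARD('a)"
    using char CHAR_dvd_CARD[where ?'a = 'a] by (metis dvd_imp_le finite_UNIV_card_ge_0 finite)
  \<comment> \<open>A prime above 3 is at least 5, which makes room for comparing quartic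
    coefficients.\<close>
  then have card: "4 < CARD('a)"
  proof -
    have "p \<noteq> 4"
      using p(1) prime_nat_iff[of 4] by (auto intro!: exI[of _ 2])
    with \<open>p > 3\<close> \<open>p \<le> CARD('a)\<close> show ?thesis by linarith
  qed
  obtain r :: 'a where r: "r ^ 2 = - 3"
    using minus_3_square[OF cong] by blast
  obtain R S :: "(7, 'a) mpoly" and t d :: 'a
    where RS: "total_degree R \<le> 2" "total_degree S \<le> 2" and d: "\<nexists>e. d = e ^ 2"
      and F: "\<And>\<sigma>. eval_mpoly \<sigma> (hypersurface_F f\<^sub>1 f\<^sub>2 f\<^sub>3) =
           (eval_mpoly \<sigma> R + t * eval_mpoly \<sigma> S) ^ 2 - d * eval_mpoly \<sigma> S ^ 2"
    using splitting_norm_form[OF splits p two] by metis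
  \<comment> \<open>The reversed order pairs each polynomial with its coordinate difference: X_1 -
    X_4 multiplies the difference of \<open>f\<^sub>3\<close>.\<close>
  define P where "P = triple f\<^sub>3 f\<^sub>2 f\<^sub>1"
  have F': "eval_mpoly (pair_point 1 x y) (hypersurface_F f\<^sub>1 f\<^sub>2 f\<^sub>3) =
      (\<Sum>i\<in>UNIV. (x i - y i) * (eval_mpoly y (P i) - eval_mpoly x (P i)))" for x y
  proof -
    \<comment> \<open>\<open>sum_3\<close> uses the indices 1, 2, 3, and 3 = 0 in the index
      type.\<close>
    have "x 3 = x 0" "y 3 = y 0"
      by (rule arg_cong[of "3::3"], simp)+
    then show ?thesis
      by (simp add: eval_hypersurface_F pair_point_def eval3_eq_eval_mpoly P_def triple_def sum_3)
  qed
  \<comment> \<open>The hypersurface contains the diagonal, and the norm form of the nonsquare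
    \<open>d\<close> is zero only at the origin.\<close>
  have diag: "eval_mpoly (pair_point 1 w w) S = 0" "eval_mpoly (pair_point 1 w w) R = 0" for w
  proof -
    let ?R = "eval_mpoly (pair_point 1 w w) R" and ?S = "eval_mpoly (pair_point 1 w w) S"
    have eq: "(?R + t * ?S) ^ 2 = d * ?S ^ 2"
      using F[of "pair_point 1 w w"] by (simp add: F')
    show S: "?S = 0"
    proof (rule ccontr)
      assume "?S \<noteq> 0"
      with eq have "d = ((?R + t * ?S) / ?S) ^ 2"
        by (simp add: power_divide)
      with d show False by blast
    qed
    show "?R = 0"
      using eq by (simp add: S)
  qed
  have card2: "2 < CARD('a)"
    using card by simp
  obtain a\<^sub>1 a\<^sub>2 L where L: "bilinear_fun L"
    and a: "\<And>t u. a\<^sub>1 (vscale t u) = t * a\<^sub>1 u" "\<And>t u. a\<^sub>2 (vscale t u) = t ^ 2 * a\<^sub>2 u"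
    and R: "\<And>u w. eval_mpoly (pair_point 1 (vadd w u) (vadd w (vscale (- 1) u))) R
           = a\<^sub>1 u + a\<^sub>2 u + L u w"
    using quadric_through_diagonal[OF RS(1) card2 diag(2)] by metis
  obtain b\<^sub>1 b\<^sub>2 M where M: "bilinear_fun M"
    and b: "\<And>t u. b\<^sub>1 (vscale t u) = t * b\<^sub>1 u" "\<And>t u. b\<^sub>2 (vscale t u) = t ^ 2 * b\<^sub>2 u"
    and S: "\<And>u w. eval_mpoly (pair_point 1 (vadd w u) (vadd w (vscale (- 1) u))) S
           = b\<^sub>1 u + b\<^sub>2 u + M u w"
    using quadric_through_diagonal[OF RS(2) card2 diag(1)] by metis
  have "\<exists>c l B T. linear_fun l \<and> bilinear_fun B \<and> trilinear_fun T \<and>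
      (\<forall>x. eval_mpoly x (P i) = c + l x + B x x + T x x x) \<and>
      (\<forall>x. homogeneous_part 3 (P i) x = T x x x)" for i
  proof -
    have "total_degree (P i) \<le> 3"
      using deg by (simp add: P_def triple_def)
    then show ?thesis
      using cubic_mpoly_expansion[of "P i"] by metis
  qed
  then obtain c l B T where l: "\<And>i. linear_fun (l i)" and B: "\<And>i. bilinear_fun (B i)"
    and T: "\<And>i. trilinear_fun (T i)"
    and P: "\<And>i x. eval_mpoly x (P i) = c i + l i x + B i x x + T i x x x"
    and P3: "\<And>i x. homogeneous_part 3 (P i) x = T i x x x"
    by metis
  \<comment> \<open>Index 0 belongs to \<open>f\<^sub>3\<close>. The first square is that of R + t
    S, so its coefficient functions are those of R plus \<open>t\<close> times those of S.\<close>
  have "T 0 x x x = 0" for x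
  proof (rule cubic_part_eq_0[OF card two three d r l B T P _ M _ _ b,
        where a\<^sub>1 = "\<lambda>u. a\<^sub>1 u + t * b\<^sub>1 u" and a\<^sub>2 = "\<lambda>u. a\<^sub>2 u + t * b\<^sub>2 u"
          and L = "\<lambda>u w. L u w + t * M u w"])
    show "bilinear_fun (\<lambda>u w. L u w + t * M u w)"
      using L M by (simp add: bilinear_fun_def linear_fun_def algebra_simps)
    show "- 2 * (\<Sum>i\<in>UNIV. u i * (eval_mpoly (vadd w u) (P i) -
          eval_mpoly (vadd w (vscale (- 1) u)) (P i))) =
        (a\<^sub>1 u + t * b\<^sub>1 u + (a\<^sub>2 u + t * b\<^sub>2 u) + (L u w + t * M u w)) ^ 2 -
          d * (b\<^sub>1 u + b\<^sub>2 u + M u w) ^ 2" for u w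
    proof -
      have "- 2 * (\<Sum>i\<in>UNIV. u i * (eval_mpoly (vadd w u) (P i) -
          eval_mpoly (vadd w (vscale (- 1) u)) (P i)))
        = eval_mpoly (pair_point 1 (vadd w u) (vadd w (vscale (- 1) u))) (hypersurface_F f\<^sub>1 f\<^sub>2 f\<^sub>3)"
        unfolding F' sum_distrib_left
        by (intro sum.cong) (simp_all add: vadd_apply vscale_apply algebra_simps)
      also have "\<dots> = (a\<^sub>1 u + t * b\<^sub>1 u + (a\<^sub>2 u + t * b\<^sub>2 u) + (L u w + t * M u w)) ^ 2 -
          d * (b\<^sub>1 u + b\<^sub>2 u + M u w) ^ 2"
        unfolding F R S by (simp add: algebra_simps)
      finally show ?thesis .
    qed
  qed (simp_all add: a b algebra_simps)
  then have "homogeneous_part 3 f\<^sub>3 x = 0" for x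
    using P3[of 0] by (simp add: P_def triple_def)
  then show False
    using homogeneous_part_nonzero[OF deg(3)] card by simp
qed

theorem theorem5p2:
  fixes p h q :: nat
    and f\<^sub>1 f\<^sub>2 f\<^sub>3 :: "(3, 'a::{field,finite}) mpoly"
  assumes "Factorial_Ring.prime p" and "p > 3" and "h \<ge> 1" and "q = p ^ h"
    and "CARD('a) = q"
    and "[q = 1] (mod 3)"
    and "real q > 6.3 * 4 powr (13 / 3)"
    and "total_degree f\<^sub>1 = 3" and "total_degree f\<^sub>2 = 3" and "total_degree f\<^sub>3 = 3"
    and "eval3 f\<^sub>1 0 0 0 = 0" and "eval3 f\<^sub>2 0 0 0 = 0" and "eval3 f\<^sub>3 0 0 0 = 0"
    and "splits_into_conjugate_quadrics (hypersurface_F f\<^sub>1 f\<^sub>2 f\<^sub>3)"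
  shows "\<not> ovoid hyperbolic_form (O7 f\<^sub>1 f\<^sub>2 f\<^sub>3)"
  \<comment> \<open>The splitting hypothesis is contradictory, so the conclusion follows
    vacuously.\<close>
  using not_splits_into_conjugate_quadrics[of p h f\<^sub>1 f\<^sub>2 f\<^sub>3] assms by simp

end
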